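(* Every solution $(\rho^n_{i,j},\mathbf v^n_{i,j},\Lambda^n_{i,j})$ of the fully discrete scheme (S1)--(S3), (B1), (B2) described in the context conserves mass: $$\sum_{i,j=0}^K\rho^{n+1}_{i,j}=\sum_{i,j=0}^K\rho^n_{i,j}\qquad\text{for all } n\in\{0,\dots,N-1\}.$$
   Context: Setting. $\Omega=[0,1]^2$, $K\in\mathbb N$, $h=1/K$; grid functions are indexed by $(i,j)\in\{0,\dots,K\}^2$, corresponding to the points $(ih,jh)$. Times $0=t_0<\dots<t_N=T$, $\tau_n=t_{n+1}-t_n$. $M>0$ is the Mach number, $\gamma>0$ a capillarity coefficient, $\mu_h$ an artificial viscosity coefficient. $W\in C^2((0,\infty),[0,\infty))$ is an energy density decomposed as $W=U-V$ with $U,V$ convex $C^2$-functions. Write $\mathbf v=(u,w)^T$. Difference operators, for a scalar grid function $f$ and a vector grid function $\mathbf f=(f^1,f^2)^T$: $(\nabla_h f)_{i,j}=\frac1{2h}(f_{i+1,j}-f_{i-1,j},\,f_{i,j+1}-f_{i,j-1})^T$; $(\operatorname{div}_h\mathbf f)_{i,j}=\frac1{2h}(f^1_{i+1,j}-f^1_{i-1,j}+f^2_{i,j+1}-f^2_{i,j-1})$; $(\Delta_hf)_{i,j}=\frac1{h^2}(f_{i+1,j}+f_{i-1,j}+f_{i,j+1}+f_{i,j-1}-4f_{i,j})$ (componentwise on vectors); $(\widetilde{\operatorname{div}}_h(\rho\mathbf v\otimes\mathbf v))_{i,j}=\frac1{4h}\big((\mathbf v_{i,j}+\mathbf v_{i+1,j})(\rho_{i,j}u_{i,j}+\rho_{i+1,j}u_{i+1,j})-(\mathbf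 v_{i,j}+\mathbf v_{i-1,j})(\rho_{i,j}u_{i,j}+\rho_{i-1,j}u_{i-1,j})+(\mathbf v_{i,j}+\mathbf v_{i,j+1})(\rho_{i,j}w_{i,j}+\rho_{i,j+1}w_{i,j+1})-(\mathbf v_{i,j}+\mathbf v_{i,j-1})(\rho_{i,j}w_{i,j}+\rho_{i,j-1}w_{i,j-1})\big)$. Scheme, for $(i,j)\in\{0,\dots,K\}^2$ and $n\in\{0,\dots,N-1\}$: (S1) $\rho^{n+1}_{i,j}-\rho^n_{i,j}+\tau_n\operatorname{div}_h(\rho^{n+1}\mathbf v^{n+1})_{i,j}=0$; (S2) $\rho^{n+1}_{i,j}\mathbf v^{n+1}_{i,j}-\rho^n_{i,j}\mathbf v^n_{i,j}+\tau_n\widetilde{\operatorname{div}}_h(\rho^n\mathbf v^n\otimes\mathbf v^n)_{i,j}+\rho^n_{i,j}\frac{\tau_n}{M^2}(\nabla_h\Lambda^{n+1})_{i,j}-\mu_h\tau_n(\Delta_h\mathbf v^n)_{i,j}=\mathbf 0$; (S3) $\Lambda^{n+1}_{i,j}-U'(\rho^{n+1}_{i,j})+V'(\rho^n_{i,j})+\gamma(\Delta_h\rho^{n+1})_{i,j}=0$. Boundary conditions (ghost cells), at all time levels: (B1) $\rho_{-1,j}=\rho_{0,j}$, $\rho_{K+1,j}=\rho_{K,j}$, $\rho_{i,-1}=\rho_{i,0}$, $\rho_{i,K+1}=\rho_{i,K}$, and analogously for $\Lambda$; (B2) $\mathbf v_{-1,j}=-\mathbf v_{0,j}$, $\mathbf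 v_{K+1,j}=-\mathbf v_{K,j}$, $\mathbf v_{i,-1}=-\mathbf v_{i,0}$, $\mathbf v_{i,K+1}=-\mathbf v_{i,K}$. All difference operators use these extensions. *)

theory Defs
  imports "HOL-Analysis.Analysis"
begin

definition C2_on :: "real set \<Rightarrow> (real \<Rightarrow> real) \<Rightarrow> bool" where
  "C2_on S f \<longleftrightarrow> (\<exists>f' f''. (\<forall>x\<in>S. (f has_real_derivative f' x) (at x)) \<and>
     (\<forall>x\<in>S. (f' has_real_derivative f'' x) (at x)) \<and> continuous_on S f'')"

text \<open>Grid functions are indexed by integers so that the ghost cells with index \<open>-1\<close> and
  \<open>K + 1\<close> are available; only the values on \<open>{0..K}\<close> and on the ghost cells adjacent to it are
  ever constrained or used. The Laplacian is polymorphic; on \<open>real^2\<close> it acts componentwise.\<close>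

type_synonym 'a grid = "int \<Rightarrow> int \<Rightarrow> 'a"

definition grad_h :: "real \<Rightarrow> real grid \<Rightarrow> (real^2) grid" where
  "grad_h h f i j =
     (1 / (2 * h)) *\<^sub>R vector [f (i + 1) j - f (i - 1) j, f i (j + 1) - f i (j - 1)]"

definition div_h :: "real \<Rightarrow> (real^2) grid \<Rightarrow> real grid" where
  "div_h h f i j =
     1 / (2 * h) * (f (i + 1) j $ 1 - f (i - 1) j $ 1 + f i (j + 1) $ 2 - f i (j - 1) $ 2)"

definition laplace_h :: "real \<Rightarrow> 'a::real_vector grid \<Rightarrow> 'a grid" where
  "laplace_h h f i j =
     (1 / h\<^sup>2) *\<^sub>R (f (i + 1) j + f (i - 1) j + f i (j + 1) + f i (j - 1) - 4 *\<^sub>R f i j)"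

definition conv_h :: "real \<Rightarrow> real grid \<Rightarrow> (real^2) grid \<Rightarrow> (real^2) grid" where
  "conv_h h \<rho> v i j = (1 / (4 * h)) *\<^sub>R
     ((\<rho> i j * v i j $ 1 + \<rho> (i + 1) j * v (i + 1) j $ 1) *\<^sub>R (v i j + v (i + 1) j)
    - (\<rho> i j * v i j $ 1 + \<rho> (i - 1) j * v (i - 1) j $ 1) *\<^sub>R (v i j + v (i - 1) j)
    + (\<rho> i j * v i j $ 2 + \<rho> i (j + 1) * v i (j + 1) $ 2) *\<^sub>R (v i j + v i (j + 1))
    - (\<rho> i j * v i j $ 2 + \<rho> i (j - 1) * v i (j - 1) $ 2) *\<^sub>R (v i j + v i (j - 1)))"

definition even_ghost :: "nat \<Rightarrow> real grid \<Rightarrow> bool" where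
  "even_ghost K f \<longleftrightarrow> (\<forall>k\<in>{0..int K}.
     f (- 1) k = f 0 k \<and> f (int K + 1) k = f (int K) k \<and>
     f k (- 1) = f k 0 \<and> f k (int K + 1) = f k (int K))"

definition odd_ghost :: "nat \<Rightarrow> (real^2) grid \<Rightarrow> bool" where
  "odd_ghost K v \<longleftrightarrow> (\<forall>k\<in>{0..int K}.
     v (- 1) k = - v 0 k \<and> v (int K + 1) k = - v (int K) k \<and>
     v k (- 1) = - v k 0 \<and> v k (int K + 1) = - v k (int K))"

text \<open>Superscripts \<open>n\<close> become the first argument of \<open>\<rho>\<close>, \<open>v\<close>, \<open>\<Lambda>\<close>. The derivatives of \<open>U\<close>, \<open>V\<close>
  are the mathematical ones wherever \<open>\<rho>\<close> is in the domain \<open>(0,\<infinity>)\<close>; positivity of \<open>\<rho>\<close> is not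
  made part of the notion of solution, so positive solutions are included as a special case.\<close>

definition scheme_solution ::
  "nat \<Rightarrow> real \<Rightarrow> nat \<Rightarrow> (nat \<Rightarrow> real) \<Rightarrow> real \<Rightarrow> real \<Rightarrow> real \<Rightarrow> (real \<Rightarrow> real) \<Rightarrow> (real \<Rightarrow> real) \<Rightarrow>
   (nat \<Rightarrow> real grid) \<Rightarrow> (nat \<Rightarrow> (real^2) grid) \<Rightarrow> (nat \<Rightarrow> real grid) \<Rightarrow> bool" where
  "scheme_solution K h N \<tau> M \<gamma> \<mu> U V \<rho> v \<Lambda> \<longleftrightarrow>
     (\<forall>n<N. \<forall>i\<in>{0..int K}. \<forall>j\<in>{0..int K}.
        \<rho> (n + 1) i j - \<rho> n i j
          + \<tau> n * div_h h (\<lambda>i j. \<rho> (n + 1) i j *\<^sub>R v (n + 1) i j) i j = 0 \<and>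
        \<rho> (n + 1) i j *\<^sub>R v (n + 1) i j - \<rho> n i j *\<^sub>R v n i j
          + \<tau> n *\<^sub>R conv_h h (\<rho> n) (v n) i j
          + (\<rho> n i j * (\<tau> n / M\<^sup>2)) *\<^sub>R grad_h h (\<Lambda> (n + 1)) i j
          - (\<mu> * \<tau> n) *\<^sub>R laplace_h h (v n) i j = 0 \<and>
        \<Lambda> (n + 1) i j - deriv U (\<rho> (n + 1) i j) + deriv V (\<rho> n i j)
          + \<gamma> * laplace_h h (\<rho> (n + 1)) i j = 0) \<and>
     (\<forall>n\<le>N. even_ghost K (\<rho> n) \<and> even_ghost K (\<Lambda> n) \<and> odd_ghost K (v n))"

end

theory Submission
  imports Defs
begin

text \<open>Mass conservation is the discrete divergence theorem. By the continuity equation, the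
  total mass changes in one step by \<open>-\<tau>\<^sub>n\<close> times the sum over the grid of the central-difference divergence of the momentum
  \<open>\<rho> v\<close>. Along every grid line central differences telescope with step two
  (\<open>sum_central_difference\<close>), so only the two
  values on either side of each boundary survive, and they enter as a sum: the ghost value plus the
  value in the adjacent boundary cell. Even reflection of \<open>\<rho>\<close> and odd reflection of \<open>v\<close> make
  \<open>\<rho> v\<close> odd, hence each of these sums vanishes (\<open>sum_div_h_odd_ghost\<close>).\<close>

lemma sum_central_difference:
  fixes g :: "int \<Rightarrow> 'a::ab_group_add"
  shows "(\<Sum>i=0..int K. g (i + 1) - g (i - 1))
    = (g (int K + 1) + g (int K)) - (g 0 + g (- 1))"
proof (induction K)
  case 0
  show ?case by simp
next
  case (Suc K)
  have "{0..int (Suc K)} = insert (int K + 1) {0..int K}" by auto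
  then show ?case using Suc by (simp add: algebra_simps)
qed

lemma odd_ghost_scaleR:
  assumes "even_ghost K \<rho>" and "odd_ghost K v"
  shows "odd_ghost K (\<lambda>i j. \<rho> i j *\<^sub>R v i j)"
  using assms by (simp add: even_ghost_def odd_ghost_def)

text \<open>Each component is summed first in the direction of its own difference, so that the boundary
  contributions cancel line by line.\<close>

lemma sum_div_h_odd_ghost:
  assumes "odd_ghost K f"
  shows "(\<Sum>i=0..int K. \<Sum>j=0..int K. div_h h f i j) = 0"
proof -
  let ?I = "{0..int K}"
  have horizontal: "(\<Sum>i\<in>?I. f (i + 1) j $ 1 - f (i - 1) j $ 1) = 0" if "j \<in> ?I" for j
    using assms that sum_central_difference[of "\<lambda>i. f i j $ 1" K] by (simp add: odd_ghost_def)
  have vertical: "(\<Sum>j\<in>?I. f i (j + 1) $ 2 - f i (j - 1) $ 2) = 0" if "i \<in> ?I" for i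
    using assms that sum_central_difference[of "\<lambda>j. f i j $ 2" K] by (simp add: odd_ghost_def)
  have "(\<Sum>i\<in>?I. \<Sum>j\<in>?I. div_h h f i j)
      = 1 / (2 * h) * ((\<Sum>i\<in>?I. \<Sum>j\<in>?I. f (i + 1) j $ 1 - f (i - 1) j $ 1)
          + (\<Sum>i\<in>?I. \<Sum>j\<in>?I. f i (j + 1) $ 2 - f i (j - 1) $ 2))"
    unfolding div_h_def sum_distrib_left[symmetric] sum.distrib[symmetric]
    by (simp add: add_diff_eq)
  also have "(\<Sum>i\<in>?I. \<Sum>j\<in>?I. f (i + 1) j $ 1 - f (i - 1) j $ 1)
      = (\<Sum>j\<in>?I. \<Sum>i\<in>?I. f (i + 1) j $ 1 - f (i - 1) j $ 1)"
    by (rule sum.swap)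
  also have "\<dots> = 0"
    using horizontal by (intro sum.neutral) blast
  also have "(\<Sum>i\<in>?I. \<Sum>j\<in>?I. f i (j + 1) $ 2 - f i (j - 1) $ 2) = 0"
    using vertical by (intro sum.neutral) blast
  finally show ?thesis by simp
qed

theorem mainTheorem4:
  fixes K N :: nat and h T M \<gamma> \<mu> :: real and t \<tau> :: "nat \<Rightarrow> real"
    and W U V :: "real \<Rightarrow> real"
    and \<rho> \<Lambda> :: "nat \<Rightarrow> real grid" and v :: "nat \<Rightarrow> (real^2) grid"
  assumes "K \<ge> 1" and "h = 1 / real K"
    and "t 0 = 0" and "\<forall>n<N. t n < t (n + 1)" and "t N = T"
    and "\<forall>n<N. \<tau> n = t (n + 1) - t n"
    and "M > 0" and "\<gamma> > 0"
    and "C2_on {0<..} W" and "\<forall>x>0. W x \<ge> 0"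
    and "\<forall>x>0. W x = U x - V x"
    and "C2_on {0<..} U" and "convex_on {0<..} U"
    and "C2_on {0<..} V" and "convex_on {0<..} V"
    and "scheme_solution K h N \<tau> M \<gamma> \<mu> U V \<rho> v \<Lambda>"
  shows "\<forall>n<N. (\<Sum>i=0..int K. \<Sum>j=0..int K. \<rho> (n + 1) i j) = (\<Sum>i=0..int K. \<Sum>j=0..int K. \<rho> n i j)"
proof (intro allI impI)
  fix n assume "n < N"
  let ?I = "{0..int K}"
  let ?m = "\<lambda>i j. \<rho> (n + 1) i j *\<^sub>R v (n + 1) i j"
  have ghosts: "even_ghost K (\<rho> (n + 1))" "odd_ghost K (v (n + 1))"
    and continuity: "\<And>i j. i \<in> ?I \<Longrightarrow> j \<in> ?I \<Longrightarrow>
      \<rho> (n + 1) i j = \<rho> n i j - \<tau> n * div_h h ?m i j"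
    using assms(16) \<open>n < N\<close> unfolding scheme_solution_def
    by (auto simp: algebra_simps eq_neg_iff_add_eq_0)
  have "(\<Sum>i\<in>?I. \<Sum>j\<in>?I. \<rho> (n + 1) i j)
      = (\<Sum>i\<in>?I. \<Sum>j\<in>?I. \<rho> n i j - \<tau> n * div_h h ?m i j)"
    by (intro sum.cong refl continuity)
  also have "\<dots> = (\<Sum>i\<in>?I. \<Sum>j\<in>?I. \<rho> n i j) - \<tau> n * (\<Sum>i\<in>?I. \<Sum>j\<in>?I. div_h h ?m i j)"
    by (simp add: sum_subtractf sum_distrib_left)
  also have "\<dots> = (\<Sum>i\<in>?I. \<Sum>j\<in>?I. \<rho> n i j)"
    by (simp only: sum_div_h_odd_ghost[OF odd_ghost_scaleR[OF ghosts]] mult_zero_right diff_zero)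
  finally show "(\<Sum>i=0..int K. \<Sum>j=0..int K. \<rho> (n + 1) i j) = (\<Sum>i=0..int K. \<Sum>j=0..int K. \<rho> n i j)" .
qed

end
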